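(* Fix $\varepsilon\in(0,1/8]$. For every $\delta>0$, there exist infinitely many $n$ and bipartite DAGs on $n$ vertices for which any non-adaptive two-sided $\varepsilon$-tester for monotonicity (with range $\mathbb{R}$) needs \[ q=\Omega\!\left(\frac{n^{1/2-\delta}}{\sqrt{\varepsilon}}\right) \] queries.
   Context: A DAG $G=(V,E)$ with $n=|V|$ vertices is given explicitly to the tester. For $u,v\in V$ write $u\leadsto v$ if there is a directed path from $u$ to $v$. A function $f:V\to\mathbb{R}$ is monotone if $f(u)\le f(v)$ whenever $u\leadsto v$. Let $d_{\mathrm{mon}}(f)$ be the minimum number of vertices at which $f$ must be changed to obtain a monotone function; $f$ is $\varepsilon$-far from monotone if $d_{\mathrm{mon}}(f)>\varepsilon n$. An $\varepsilon$-tester is a randomized algorithm with oracle access to $f$ that accepts every monotone $f$ with probability at least $2/3$ and rejects every $\varepsilon$-far $f$ with probability at least $2/3$ (two-sided error). It is non-adaptive if its set of queried vertices depends only on its internal randomness. Only oracle queries to $f$ are counted. A bipartite DAG is one whose vertex set is partitioned into $L$ and $R$ with all edges directed from $L$ to $R$. *)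

theory Defs
  imports "HOL-Probability.Probability"
begin

definition dag :: "'v set \<Rightarrow> 'v rel \<Rightarrow> bool" where
  "dag V E \<longleftrightarrow> finite V \<and> E \<subseteq> V \<times> V \<and> acyclic E"

definition bipartite_dag :: "'v set \<Rightarrow> 'v rel \<Rightarrow> bool" where
  "bipartite_dag V E \<longleftrightarrow>
     dag V E \<and> (\<exists>L R. L \<union> R = V \<and> L \<inter> R = {} \<and> E \<subseteq> L \<times> R)"

text \<open>A function on \<open>V\<close> is represented by a total function on the vertex type, of which
  only the values on \<open>V\<close> matter.\<close>

definition dag_monotone :: "'v set \<Rightarrow> 'v rel \<Rightarrow> ('v \<Rightarrow> real) \<Rightarrow> bool" where
  "dag_monotone V E f \<longleftrightarrow> monotone_on V (\<lambda>u v. (u, v) \<in> E\<^sup>*) (\<le>) f"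

definition d_mon :: "'v set \<Rightarrow> 'v rel \<Rightarrow> ('v \<Rightarrow> real) \<Rightarrow> nat" where
  "d_mon V E f = (LEAST k. \<exists>g. dag_monotone V E g \<and> card {v \<in> V. f v \<noteq> g v} = k)"

definition far_from_monotone :: "'v set \<Rightarrow> 'v rel \<Rightarrow> real \<Rightarrow> ('v \<Rightarrow> real) \<Rightarrow> bool" where
  "far_from_monotone V E \<epsilon> f \<longleftrightarrow> real (d_mon V E f) > \<epsilon> * real (card V)"

text \<open>Deterministic algorithms with oracle access to a real-valued function: decision trees
  that branch on the answer to each query. All computation between queries is free.\<close>

datatype 'v query_alg = Answer bool | Query 'v "real \<Rightarrow> 'v query_alg"

primrec accepts :: "'v query_alg \<Rightarrow> ('v \<Rightarrow> real) \<Rightarrow> bool" where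
  "accepts (Answer b) f = b"
| "accepts (Query v k) f = accepts (k (f v)) f"

primrec queried :: "'v query_alg \<Rightarrow> ('v \<Rightarrow> real) \<Rightarrow> 'v set" where
  "queried (Answer b) f = {}"
| "queried (Query v k) f = insert v (queried (k (f v)) f)"

text \<open>A randomized algorithm is a probability measure \<open>M\<close> on deterministic algorithms: fixing
  the internal randomness leaves a deterministic algorithm. The \<open>\<sigma>\<close>-algebra is arbitrary, subject
  only to acceptance being an event for every input. This covers every source of randomness,
  since a seed space can be pushed forward along the map from seeds to algorithms (with the
  largest \<open>\<sigma>\<close>-algebra making that map measurable).\<close>

definition monotonicity_tester ::
  "'v set \<Rightarrow> 'v rel \<Rightarrow> real \<Rightarrow> 'v query_alg measure \<Rightarrow> bool" where
  "monotonicity_tester V E \<epsilon> M \<longleftrightarrow>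
     prob_space M \<and>
     (\<forall>A \<in> space M. \<forall>f. queried A f \<subseteq> V) \<and>
     (\<forall>f. Measurable.pred M (\<lambda>A. accepts A f)) \<and>
     (\<forall>f. dag_monotone V E f \<longrightarrow> \<P>(A in M. accepts A f) \<ge> 2 / 3) \<and>
     (\<forall>f. far_from_monotone V E \<epsilon> f \<longrightarrow> \<P>(A in M. \<not> accepts A f) \<ge> 2 / 3)"

definition nonadaptive :: "'v query_alg measure \<Rightarrow> bool" where
  "nonadaptive M \<longleftrightarrow> (\<forall>A \<in> space M. \<forall>f g. queried A f = queried A g)"

text \<open>Repeated queries to the same vertex are counted once; this only favours the tester.\<close>

definition makes_at_most_queries :: "'v query_alg measure \<Rightarrow> nat \<Rightarrow> bool" where
  "makes_at_most_queries M q \<longleftrightarrow> (\<forall>A \<in> space M. \<forall>f. card (queried A f) \<le> q)"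

end

theory Submission
  imports Defs "HOL-Real_Asymp.Real_Asymp"
begin

text \<open>The edges of the graph split into many matchings of linear size such that for each matching
  there is a height function that is constant on its edges and strictly increasing along all other
  edges. Hide a uniformly random matching and raise the height by \<open>1 / 2\<close> at random endpoints of its
  edges: either both endpoints of an edge together, which keeps the function monotone, or exactly
  one of them, which violates about half of the edges. The two distributions agree on every query
  set that contains no edge of the hidden matching, and \<open>q\<close> queries contain edges of at most \<open>q\<^sup>2\<close>
  matchings, so \<open>q\<^sup>2\<close> must be of the order of the number of matchings. As that number exceeds
  \<open>n powr (1 - 2 * \<delta>)\<close> by a positive power of \<open>n\<close>, large \<open>n\<close> absorbs the factor \<open>1 / sqrt \<epsilon>\<close>.\<close>

section \<open>Query trees, monotonicity on edges and distance to monotonicity\<close>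

lemma accepts_cong_queried:
  "(\<And>v. v \<in> queried A f \<Longrightarrow> f v = g v) \<Longrightarrow> accepts A f = accepts A g"
  by (induction A) auto

lemma dag_monotone_iff_edges:
  assumes "E \<subseteq> V \<times> V"
  shows "dag_monotone V E f \<longleftrightarrow> (\<forall>(u, v) \<in> E. f u \<le> f v)"
proof
  assume "dag_monotone V E f"
  then show "\<forall>(u, v) \<in> E. f u \<le> f v"
    using assms unfolding dag_monotone_def monotone_on_def by blast
next
  assume edges: "\<forall>(u, v) \<in> E. f u \<le> f v"
  have "f u \<le> f v" if "(u, v) \<in> E\<^sup>*" for u v
    using that by (induction rule: rtrancl_induct) (use edges in \<open>force+\<close>)
  then show "dag_monotone V E f"
    unfolding dag_monotone_def monotone_on_def by blast
qed

text \<open>A monotone function must differ from \<open>f\<close> at an endpoint of every violated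
  edge, and the edges of \<open>P\<close> are vertex-disjoint, so these endpoints are
  distinct.\<close>

lemma card_violated_matching_le_d_mon:
  assumes "finite V" "E \<subseteq> V \<times> V" "P \<subseteq> E" "inj_on fst P" "inj_on snd P"
    and disj: "fst ` P \<inter> snd ` P = {}"
    and viol: "\<And>u v. (u, v) \<in> P \<Longrightarrow> f v < f u"
  shows "card P \<le> d_mon V E f"
proof -
  let ?Q = "\<lambda>k. \<exists>g. dag_monotone V E g \<and> card {v \<in> V. f v \<noteq> g v} = k"
  have "dag_monotone V E (\<lambda>_. 0)"
    by (simp add: dag_monotone_def monotone_on_def)
  then have "\<exists>k. ?Q k" by blast
  then have "?Q (d_mon V E f)"
    unfolding d_mon_def by (rule LeastI_ex)
  then obtain g where g: "dag_monotone V E g" and card_g: "card {v \<in> V. f v \<noteq> g v} = d_mon V E f"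
    by blast
  define w where "w e = (if f (fst e) \<noteq> g (fst e) then fst e else snd e)" for e
  have "w e \<in> {v \<in> V. f v \<noteq> g v}" if "e \<in> P" for e
  proof -
    obtain u v where e: "e = (u, v)" by force
    have "(u, v) \<in> E" using that e assms(3) by blast
    then have "g u \<le> g v" "u \<in> V" "v \<in> V"
      using g assms(2) by (auto simp: dag_monotone_iff_edges[OF assms(2)])
    moreover have "f v < f u" using viol that e by blast
    ultimately show ?thesis by (auto simp: w_def e)
  qed
  moreover have "inj_on w P"
  proof (rule inj_onI)
    fix e e' assume ee: "e \<in> P" "e' \<in> P" and eq: "w e = w e'"
    have "fst e \<noteq> snd e'" "fst e' \<noteq> snd e"
      using disj ee by (metis IntI empty_iff imageI)+
    with eq have "fst e = fst e' \<or> snd e = snd e'"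
      by (auto simp: w_def split: if_splits)
    then show "e = e'"
      using assms(4,5) ee by (auto dest: inj_onD)
  qed
  ultimately have "card P \<le> card {v \<in> V. f v \<noteq> g v}"
    using assms(1) by (intro card_inj_on_le[of w]) auto
  then show ?thesis using card_g by simp
qed

section \<open>Concentration of the size of a random subset\<close>

text \<open>This is the variance of a sum of \<open>card S\<close> independent signs: a new element
  shifts the deviation by 1 or -1, and the cross terms cancel.\<close>

lemma sum_Pow_card_deviation_sq:
  assumes "finite S"
  shows "(\<Sum>P\<in>Pow S. (real (card S) - 2 * real (card P))\<^sup>2) = real (card S) * 2 ^ card S"
  using assms
proof (induction S rule: finite_induct)
  case empty
  then show ?case by simp
next
  case (insert x S)
  let ?t = "\<lambda>P. real (card S) - 2 * real (card P)"
  have card_ins: "card (insert x P) = Suc (card P)" if "P \<in> Pow S" for P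
    using that insert by (metis PowD card_insert_disjoint finite_subset subsetD)
  have inj: "inj_on (insert x) (Pow S)"
    using insert(2) by (auto simp: inj_on_def)
  have "(\<Sum>P\<in>Pow (insert x S). (real (card (insert x S)) - 2 * real (card P))\<^sup>2)
      = (\<Sum>P\<in>Pow S. (?t P + 1)\<^sup>2) + (\<Sum>P\<in>insert x ` Pow S. (?t P + 1)\<^sup>2)"
    unfolding Pow_insert using insert
    by (subst sum.union_disjoint) (auto simp: algebra_simps)
  also have "(\<Sum>P\<in>insert x ` Pow S. (?t P + 1)\<^sup>2) = (\<Sum>P\<in>Pow S. (?t P - 1)\<^sup>2)"
    by (subst sum.reindex[OF inj]) (auto intro!: sum.cong simp: card_ins algebra_simps)
  also have "(\<Sum>P\<in>Pow S. (?t P + 1)\<^sup>2) + (\<Sum>P\<in>Pow S. (?t P - 1)\<^sup>2)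
      = (\<Sum>P\<in>Pow S. 2 * (?t P)\<^sup>2 + 2)"
    by (subst sum.distrib[symmetric]) (auto intro!: sum.cong simp: power2_eq_square algebra_simps)
  also have "\<dots> = 2 * (real (card S) * 2 ^ card S) + 2 * 2 ^ card S"
    using insert by (simp add: sum.distrib sum_distrib_left[symmetric] card_Pow)
  also have "\<dots> = real (card (insert x S)) * 2 ^ card (insert x S)"
    using insert by (simp add: algebra_simps)
  finally show ?case .
qed

text \<open>Chebyshev's inequality: a subset with at most a third of the elements has deviation at
  least \<open>card S / 3\<close>.\<close>

lemma card_small_subsets_le:
  assumes "finite S"
  shows "real (card S) * real (card {P \<in> Pow S. 3 * card P \<le> card S}) \<le> 9 * 2 ^ card S"
proof (cases "S = {}")
  case False
  define B where "B = {P \<in> Pow S. 3 * card P \<le> card S}"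
  have pos: "real (card S) > 0" using False assms by (simp add: card_gt_0_iff)
  have "real (card B) * (real (card S) / 3)\<^sup>2 = (\<Sum>P\<in>B. (real (card S) / 3)\<^sup>2)"
    by simp
  also have "\<dots> \<le> (\<Sum>P\<in>B. (real (card S) - 2 * real (card P))\<^sup>2)"
    by (intro sum_mono power_mono) (auto simp: B_def)
  also have "\<dots> \<le> (\<Sum>P\<in>Pow S. (real (card S) - 2 * real (card P))\<^sup>2)"
    using assms by (intro sum_mono2) (auto simp: B_def)
  also have "\<dots> = real (card S) * 2 ^ card S"
    by (rule sum_Pow_card_deviation_sq[OF assms])
  finally have "real (card S) * (real (card S) * real (card B)) \<le> real (card S) * (9 * 2 ^ card S)"
    by (simp add: power2_eq_square field_simps)
  then show ?thesis using pos unfolding B_def by (simp only: mult_le_cancel_left_pos)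
qed simp

section \<open>The query lower bound from separated matchings\<close>

text \<open>Heights are integers so that a strict increase is at least 1 and outweighs a raise by
  1/2. By \<open>card_N\<close>, a third of a matching has at least 1/8 of the vertex count as its
  size, which matches \<epsilon> \<le> 1/8. The 54 makes the Chebyshev bound 9/54 = 1/6.\<close>

locale separated_matchings =
  fixes L R :: "'v set" and C :: "'c set" and N :: "'c \<Rightarrow> 'v rel" and h :: "'c \<Rightarrow> 'v \<Rightarrow> int"
  assumes finite_L: "finite L" and finite_R: "finite R" and disjoint: "L \<inter> R = {}"
    and finite_C: "finite C"
    and N_subset: "a \<in> C \<Longrightarrow> N a \<subseteq> L \<times> R"
    and inj_fst: "a \<in> C \<Longrightarrow> inj_on fst (N a)"
    and inj_snd: "a \<in> C \<Longrightarrow> inj_on snd (N a)"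
    and height_eq: "a \<in> C \<Longrightarrow> (u, v) \<in> N a \<Longrightarrow> h a u = h a v"
    and height_less: "a \<in> C \<Longrightarrow> b \<in> C \<Longrightarrow> a \<noteq> b \<Longrightarrow> (u, v) \<in> N b \<Longrightarrow> h a u < h a v"
    and card_N: "a \<in> C \<Longrightarrow> 3 * card (L \<union> R) \<le> 8 * card (N a)"
    and card_N_ge: "a \<in> C \<Longrightarrow> 54 \<le> card (N a)"
begin

abbreviation V :: "'v set" where "V \<equiv> L \<union> R"

definition E :: "'v rel" where "E = (\<Union>a\<in>C. N a)"

lemma finite_N: "a \<in> C \<Longrightarrow> finite (N a)"
  using N_subset finite_L finite_R by (meson finite_SigmaI finite_subset)

lemma E_subset: "E \<subseteq> L \<times> R"
  using N_subset by (auto simp: E_def)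

lemma E_subset_V: "E \<subseteq> V \<times> V"
  using E_subset by blast

lemma bipartite: "bipartite_dag V E"
proof -
  have "acyclic E"
  proof (rule acyclicI, rule allI, rule notI)
    fix x assume "(x, x) \<in> E\<^sup>+"
    then have "x \<in> Domain E" "x \<in> Range E"
      by (metis trancl_domain DomainI) (metis trancl_range RangeI \<open>(x, x) \<in> E\<^sup>+\<close>)
    then show False using E_subset disjoint by blast
  qed
  then show ?thesis
    unfolding bipartite_dag_def dag_def using E_subset E_subset_V finite_L finite_R disjoint by blast
qed

text \<open>On a common edge of two different matchings, \<open>h a\<close> would be both constant
  and strictly increasing.\<close>

lemma N_disjoint: "a \<in> C \<Longrightarrow> b \<in> C \<Longrightarrow> e \<in> N a \<Longrightarrow> e \<in> N b \<Longrightarrow> a = b"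
  using height_eq height_less by (metis less_irrefl surj_pair)

definition raised :: "'c \<Rightarrow> 'v set \<Rightarrow> 'v \<Rightarrow> real" where
  "raised a S v = of_int (h a v) + (if v \<in> S then 1 / 2 else 0)"

definition yes_fun :: "'c \<Rightarrow> 'v rel \<Rightarrow> 'v \<Rightarrow> real" where
  "yes_fun a P = raised a (fst ` P \<union> snd ` P)"

text \<open>Each edge of \<open>N a\<close> gets exactly one raised endpoint; \<open>P\<close> is
  the set of edges that become violated.\<close>

definition no_fun :: "'c \<Rightarrow> 'v rel \<Rightarrow> 'v \<Rightarrow> real" where
  "no_fun a P = raised a (fst ` P \<union> snd ` (N a - P))"

text \<open>Edges of other matchings gain at least 1 in height, more than any raise. An edge of
  \<open>N a\<close> has its endpoints raised together, since no other edge of \<open>N a\<close>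
  meets it.\<close>

lemma yes_fun_monotone:
  assumes a: "a \<in> C" and P: "P \<subseteq> N a"
  shows "dag_monotone V E (yes_fun a P)"
  unfolding dag_monotone_iff_edges[OF E_subset_V]
proof clarify
  fix u v assume "(u, v) \<in> E"
  then obtain b where b: "b \<in> C" "(u, v) \<in> N b" by (auto simp: E_def)
  show "yes_fun a P u \<le> yes_fun a P v"
  proof (cases "a = b")
    case False
    have "h a u + 1 \<le> h a v" using height_less[OF a b(1) False b(2)] by simp
    then have "real_of_int (h a u) + 1 \<le> real_of_int (h a v)" by linarith
    then show ?thesis by (simp add: yes_fun_def raised_def)
  next
    case True
    have "u \<in> fst ` P \<union> snd ` P \<Longrightarrow> v \<in> snd ` P"
    proof -
      assume "u \<in> fst ` P \<union> snd ` P"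
      moreover have "u \<notin> snd ` P"
        using b(2) True P N_subset[OF a] disjoint by fastforce
      ultimately obtain e where e: "e \<in> P" "fst e = u" by auto
      then have "e = (u, v)"
        using inj_onD[OF inj_fst[OF a], of e "(u, v)"] P b True by auto
      then show ?thesis using e by force
    qed
    then show ?thesis
      using height_eq[OF b] True by (auto simp: yes_fun_def raised_def)
  qed
qed

text \<open>All edges of \<open>P\<close> are violated, and \<open>card P\<close> exceeds a third of
  \<open>card (N a)\<close>, hence an eighth of the vertex count.\<close>

lemma no_fun_far:
  assumes a: "a \<in> C" and P: "P \<subseteq> N a" and large: "card (N a) < 3 * card P" and "\<epsilon> \<le> 1 / 8"
  shows "far_from_monotone V E \<epsilon> (no_fun a P)"
proof -
  have PLR: "P \<subseteq> L \<times> R" using P N_subset[OF a] by blast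
  have "card P \<le> d_mon V E (no_fun a P)"
  proof (rule card_violated_matching_le_d_mon)
    show "finite V" using finite_L finite_R by simp
    show "P \<subseteq> E" using P a by (auto simp: E_def)
    show "inj_on fst P" "inj_on snd P"
      using inj_fst[OF a] inj_snd[OF a] P by (auto intro: inj_on_subset)
    show "fst ` P \<inter> snd ` P = {}" using PLR disjoint by fastforce
    fix u v assume uv: "(u, v) \<in> P"
    have "v \<notin> fst ` P" using uv PLR disjoint by fastforce
    moreover have "v \<notin> snd ` (N a - P)"
    proof
      assume "v \<in> snd ` (N a - P)"
      then obtain e where e: "e \<in> N a - P" "snd e = v" by auto
      then have "e = (u, v)"
        using inj_onD[OF inj_snd[OF a], of e "(u, v)"] P uv by auto
      then show False using e uv by simp
    qed
    moreover have "u \<in> fst ` P" using uv by force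
    ultimately show "no_fun a P v < no_fun a P u"
      using height_eq[OF a, of u v] uv P by (auto simp: no_fun_def raised_def)
  qed (rule E_subset_V)
  moreover have "real (card V) < 8 * real (card P)"
    using large card_N[OF a] by linarith
  moreover have "\<epsilon> * real (card V) \<le> 1 / 8 * real (card V)"
    by (intro mult_right_mono assms) simp
  ultimately show ?thesis unfolding far_from_monotone_def by linarith
qed

text \<open>If the query set contains no edge of the matching, complementing \<open>P\<close> on the edges whose
  right endpoint is queried turns the answers for \<open>yes_fun\<close> into those for \<open>no_fun\<close>.\<close>

lemma sum_accepts_yes_eq_no:
  assumes Q: "\<And>f. queried A f = Q" and free: "N a \<inter> Q \<times> Q = {}"
  shows "(\<Sum>P\<in>Pow (N a). of_bool (accepts A (yes_fun a P)) :: real)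
       = (\<Sum>P\<in>Pow (N a). of_bool (accepts A (no_fun a P)))"
proof -
  define T where "T = {e \<in> N a. snd e \<in> Q}"
  define s where "s P = (P - T) \<union> (T - P)" for P
  have TN: "T \<subseteq> N a" by (auto simp: T_def)
  have "accepts A (yes_fun a P) = accepts A (no_fun a (s P))" if P: "P \<in> Pow (N a)" for P
  proof (rule accepts_cong_queried)
    fix v assume "v \<in> queried A (yes_fun a P)"
    then have v: "v \<in> Q" using Q by simp
    have 1: "e \<in> P \<longleftrightarrow> e \<in> s P" if "fst e = v" for e
      using that free v by (cases e) (auto simp: T_def s_def)
    have 2: "e \<in> P \<longleftrightarrow> e \<in> N a - s P" if "snd e = v" for e
      using that P v by (auto simp: T_def s_def)
    have "v \<in> fst ` P \<longleftrightarrow> v \<in> fst ` s P" using 1 by (auto simp: image_iff)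
    moreover have "v \<in> snd ` P \<longleftrightarrow> v \<in> snd ` (N a - s P)"
      unfolding image_iff using 2 by metis
    ultimately show "yes_fun a P v = no_fun a (s P) v"
      by (simp add: yes_fun_def no_fun_def raised_def)
  qed
  \<comment> \<open>\<open>s\<close> is the symmetric difference with \<open>T\<close>, an
    involution on \<open>Pow (N a)\<close>, so it reindexes the sum.\<close>
  then show ?thesis
    by (intro sum.reindex_bij_witness[of _ s s]) (use TN in \<open>auto simp: s_def\<close>)
qed

text \<open>Choosing one edge inside \<open>Q \<times> Q\<close> from each such matching is
  injective, because the matchings are disjoint.\<close>

lemma card_matchings_le_queries:
  assumes "finite Q"
  shows "card {a \<in> C. N a \<inter> Q \<times> Q \<noteq> {}} \<le> (card Q)\<^sup>2"
proof -
  define S where "S = {a \<in> C. N a \<inter> Q \<times> Q \<noteq> {}}"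
  define w where "w a = (SOME e. e \<in> N a \<inter> Q \<times> Q)" for a
  have w: "w a \<in> N a \<inter> Q \<times> Q" if "a \<in> S" for a
    unfolding w_def by (rule someI_ex) (use that in \<open>auto simp: S_def\<close>)
  have "inj_on w S"
  proof (rule inj_onI)
    fix a b assume ab: "a \<in> S" "b \<in> S" "w a = w b"
    then show "a = b" using w[of a] w[of b] N_disjoint[of a b "w a"] by (auto simp: S_def)
  qed
  then have "card S \<le> card (Q \<times> Q)"
    using w assms by (intro card_inj_on_le[of w]) blast+
  then show ?thesis by (simp add: S_def card_cartesian_product power2_eq_square)
qed

text \<open>Double counting of the advantage: the tester's expected advantage is at least 1/6 for
  each matching, while a single query set has advantage at most 1 on at most \<open>q\<close>
  squared matchings and 0 on the rest.\<close>

theorem queries_lower_bound: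
  assumes \<epsilon>: "\<epsilon> \<le> 1 / 8" and tester: "monotonicity_tester V E \<epsilon> M"
    and "nonadaptive M" and "makes_at_most_queries M q"
  shows "real (card C) / 6 \<le> (real q)\<^sup>2"
proof -
  interpret prob_space M using tester by (simp add: monotonicity_tester_def)
  define pr where "pr f = prob {A \<in> space M. accepts A f}" for f
  have ev: "{A \<in> space M. accepts A f} \<in> events" for f
    using tester by (auto simp: monotonicity_tester_def pred_def)
  have int: "integrable M (\<lambda>A. of_bool (accepts A f) :: real)"
    and ex: "expectation (\<lambda>A. of_bool (accepts A f) :: real) = pr f" for f
  proof -
    have eq: "of_bool (accepts A f) = (indicator {A \<in> space M. accepts A f} A :: real)"
      if "A \<in> space M" for A
      using that by (simp add: indicator_def)
    show "integrable M (\<lambda>A. of_bool (accepts A f) :: real)"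
      using ev[of f] by (subst Bochner_Integration.integrable_cong[OF refl eq])
        (auto simp: less_top[symmetric])
    show "expectation (\<lambda>A. of_bool (accepts A f) :: real) = pr f"
      using ev[of f] by (subst Bochner_Integration.integral_cong[OF refl eq]) (auto simp: pr_def)
  qed
  have pr_yes: "pr (yes_fun a P) \<ge> 2 / 3" if "a \<in> C" "P \<subseteq> N a" for a P
    using tester yes_fun_monotone[OF that] by (auto simp: monotonicity_tester_def pr_def)
  \<comment> \<open>For small \<open>P\<close> the function may fail to be far, so only the trivial
    bound 1 is available; \<open>of_bool\<close> accounts for it.\<close>
  have pr_no: "pr (no_fun a P) \<le> 1 / 3 + of_bool (3 * card P \<le> card (N a))"
    if "a \<in> C" "P \<subseteq> N a" for a P
  proof (cases "3 * card P \<le> card (N a)")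
    case False
    then have "far_from_monotone V E \<epsilon> (no_fun a P)"
      using no_fun_far[OF that _ \<epsilon>] by simp
    then have "prob {A \<in> space M. \<not> accepts A (no_fun a P)} \<ge> 2 / 3"
      using tester by (auto simp: monotonicity_tester_def)
    then show ?thesis
      using False prob_neg[OF ev[of "no_fun a P"]] by (simp add: pr_def)
  next
    case True
    have "pr (no_fun a P) \<le> 1" by (simp add: pr_def)
    then show ?thesis using True by simp
  qed
  \<comment> \<open>The distinguishing advantage of the deterministic algorithm \<open>A\<close> for
    the hidden matching \<open>N a\<close> with uniformly random \<open>P\<close>.\<close>
  define gap where "gap A a = (\<Sum>P\<in>Pow (N a). of_bool (accepts A (yes_fun a P))
      - of_bool (accepts A (no_fun a P))) / (2 :: real) ^ card (N a)" for A a
  have gap_int: "integrable M (\<lambda>A. gap A a)" for a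
    unfolding gap_def using int by auto
  have gap_ge: "expectation (\<lambda>A. gap A a) \<ge> 1 / 6" if a: "a \<in> C" for a
  proof -
    define B where "B = {P \<in> Pow (N a). 3 * card P \<le> card (N a)}"
    have "54 * real (card B) \<le> real (card (N a)) * real (card B)"
      using card_N_ge[OF a] by (intro mult_right_mono) auto
    also have "\<dots> \<le> 9 * 2 ^ card (N a)"
      unfolding B_def by (rule card_small_subsets_le[OF finite_N[OF a]])
    finally have B: "real (card B) \<le> 2 ^ card (N a) / 6" by simp
    \<comment> \<open>On average over \<open>P\<close> the advantage is at least 2/3 - 1/3, minus
      the fraction of small \<open>P\<close>, which is at most 1/6.\<close>
    have "2 ^ card (N a) / 6 \<le> 2 ^ card (N a) / 3 - real (card B)"
      using B by simp
    also have "\<dots> = (\<Sum>P\<in>Pow (N a). 1 / 3 - of_bool (3 * card P \<le> card (N a)))"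
      using finite_N[OF a]
      by (simp add: sum_subtractf card_Pow B_def of_bool_def sum.If_cases Int_def)
    also have "\<dots> \<le> (\<Sum>P\<in>Pow (N a). pr (yes_fun a P) - pr (no_fun a P))"
    proof (rule sum_mono)
      fix P assume "P \<in> Pow (N a)"
      then show "1 / 3 - of_bool (3 * card P \<le> card (N a)) \<le> pr (yes_fun a P) - pr (no_fun a P)"
        using pr_yes[OF a, of P] pr_no[OF a, of P] by simp
    qed
    finally have "1 / 6 \<le> (\<Sum>P\<in>Pow (N a). pr (yes_fun a P) - pr (no_fun a P)) / 2 ^ card (N a)"
      by (simp add: field_simps)
    also have "\<dots> = expectation (\<lambda>A. gap A a)"
      unfolding gap_def using int by (simp add: ex)
    finally show ?thesis .
  qed
  have gap_le: "(\<Sum>a\<in>C. gap A a) \<le> (real q)\<^sup>2" if A: "A \<in> space M" for A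
  proof -
    define Q where "Q = queried A (\<lambda>_. 0)"
    have Q: "queried A f = Q" for f
      using A assms(3) by (auto simp: nonadaptive_def Q_def)
    have "Q \<subseteq> V" using A tester by (auto simp: monotonicity_tester_def Q_def)
    then have finQ: "finite Q" using finite_L finite_R by (meson finite_UnI finite_subset)
    have cardQ: "card Q \<le> q" using A assms(4) by (auto simp: makes_at_most_queries_def Q_def)
    have "gap A a \<le> of_bool (N a \<inter> Q \<times> Q \<noteq> {})" if a: "a \<in> C" for a
    proof (cases "N a \<inter> Q \<times> Q = {}")
      case True
      then show ?thesis
        using sum_accepts_yes_eq_no[of A Q a] Q by (simp add: gap_def sum_subtractf)
    next
      case False
      have "(\<Sum>P\<in>Pow (N a). of_bool (accepts A (yes_fun a P))
          - of_bool (accepts A (no_fun a P)) :: real) \<le> (\<Sum>P\<in>Pow (N a). 1)"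
        by (intro sum_mono) auto
      then show ?thesis
        using False finite_N[OF a] by (simp add: gap_def card_Pow)
    qed
    then have "(\<Sum>a\<in>C. gap A a) \<le> (\<Sum>a\<in>C. of_bool (N a \<inter> Q \<times> Q \<noteq> {}))"
      by (intro sum_mono)
    also have "\<dots> = real (card {a \<in> C. N a \<inter> Q \<times> Q \<noteq> {}})"
      using finite_C by (simp add: of_bool_def sum.If_cases Int_def)
    also have "\<dots> \<le> real ((card Q)\<^sup>2)"
      using card_matchings_le_queries[OF finQ] by (rule of_nat_mono)
    also have "\<dots> \<le> (real q)\<^sup>2"
      using cardQ by (simp add: power_mono)
    finally show ?thesis .
  qed
  have "real (card C) / 6 = (\<Sum>a\<in>C. 1 / 6)" by simp
  also have "\<dots> \<le> (\<Sum>a\<in>C. expectation (\<lambda>A. gap A a))"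
    by (intro sum_mono gap_ge)
  also have "\<dots> = expectation (\<lambda>A. \<Sum>a\<in>C. gap A a)"
    using gap_int by simp
  also have "\<dots> \<le> expectation (\<lambda>_. (real q)\<^sup>2)"
    using gap_int gap_le by (intro integral_mono) auto
  also have "\<dots> = (real q)\<^sup>2" by (simp add: prob_space)
  finally show ?thesis .
qed

end

section \<open>Spheres in integer grids and the matchings they define\<close>

lemma pigeonhole_fibre:
  assumes "finite S" "finite T" "T \<noteq> {}" "f ` S \<subseteq> T"
  shows "\<exists>t\<in>T. card S \<le> card T * card {x \<in> S. f x = t}"
proof (rule ccontr)
  assume "\<not> ?thesis"
  then have "(\<Sum>t\<in>T. card T * card {x \<in> S. f x = t}) < (\<Sum>t\<in>T. card S)"
    using assms by (intro sum_strict_mono) (auto simp: not_le)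
  moreover have "(\<Sum>t\<in>T. card {x \<in> S. f x = t}) = card S"
    using sum.group[OF assms(1,2,4), of "\<lambda>_. 1 :: nat"] by simp
  ultimately show False by (simp add: sum_distrib_left[symmetric])
qed

text \<open>With \<open>PiE\<close>, points have a fixed value outside \<open>{..<d}\<close>, so the
  grid is finite and coordinates below \<open>d\<close> determine a point.\<close>

definition cube :: "nat \<Rightarrow> nat \<Rightarrow> (nat \<Rightarrow> int) set" where
  "cube d s = PiE {..<d} (\<lambda>_. {0..<int s})"

definition ip :: "nat \<Rightarrow> (nat \<Rightarrow> int) \<Rightarrow> (nat \<Rightarrow> int) \<Rightarrow> int" where
  "ip d x y = (\<Sum>i<d. x i * y i)"

lemma finite_cube: "finite (cube d s)"
  by (simp add: cube_def finite_PiE)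

lemma card_cube: "card (cube d s) = s ^ d"
  by (simp add: cube_def card_PiE)

text \<open>Squared norms on the grid are integers in \<open>{0..<d * k^2}\<close>; the most
  frequent value gives the sphere.\<close>

lemma ex_sphere_in_cube:
  assumes "0 < d" "0 < k"
  shows "\<exists>A r. A \<subseteq> cube d k \<and> (\<forall>a\<in>A. ip d a a = r) \<and> k ^ d \<le> d * k\<^sup>2 * card A"
proof -
  have "ip d x x \<in> {0..<int (d * k\<^sup>2)}" if "x \<in> cube d k" for x
  proof -
    have "x i * x i < (int k)\<^sup>2" if "i \<in> {..<d}" for i
      using that \<open>x \<in> cube d k\<close> by (auto simp: cube_def PiE_iff power2_eq_square intro!: mult_strict_mono)
    then have "ip d x x < of_nat (card {..<d}) * (int k)\<^sup>2"
      unfolding ip_def by (intro sum_bounded_above_strict) (use assms in auto)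
    then show ?thesis by (simp add: ip_def sum_nonneg)
  qed
  then have "(\<lambda>x. ip d x x) ` cube d k \<subseteq> {0..<int (d * k\<^sup>2)}" by blast
  moreover have "{0..<int (d * k\<^sup>2)} \<noteq> {}" using assms by simp
  ultimately obtain r where r: "card (cube d k)
      \<le> card {0..<int (d * k\<^sup>2)} * card {x \<in> cube d k. ip d x x = r}"
    using pigeonhole_fibre[OF finite_cube, of "{0..<int (d * k\<^sup>2)}" "\<lambda>x. ip d x x"] by blast
  have "card {0..<int (d * k\<^sup>2)} = d * k\<^sup>2"
    by (simp only: card_atLeastLessThan_int diff_zero nat_int)
  with r show ?thesis
    by (intro exI[of _ "{x \<in> cube d k. ip d x x = r}"] exI[of _ r]) (simp add: card_cube)
qed

text \<open>Expand the squared distance of \<open>x\<close> and \<open>y\<close>, which is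
  positive.\<close>

lemma ip_less_of_same_norm:
  assumes "x \<in> cube d k" "y \<in> cube d k" "ip d x x = ip d y y" "x \<noteq> y"
  shows "ip d x y < ip d x x"
proof -
  have "\<exists>i\<in>{..<d}. x i \<noteq> y i"
    using assms(1,2,4) unfolding cube_def by (meson PiE_ext)
  then have "0 < (\<Sum>i<d. (x i - y i)\<^sup>2)"
    by (auto intro!: sum_pos2)
  also have "\<dots> = ip d x x + ip d y y - 2 * ip d x y"
    by (simp add: ip_def power2_eq_square sum.distrib[symmetric] sum_subtractf[symmetric]
        sum_distrib_left algebra_simps)
  finally show ?thesis using assms(3) by simp
qed

text \<open>Bernoulli's inequality: shortening each of \<open>d\<close> sides by the fraction 1/(4d)
  loses at most a quarter of the grid. This is why the grid has side
  \<open>4 * d * k\<close>.\<close>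

lemma three_quarters_cube:
  assumes "0 < d"
  shows "3 * (4 * d * k) ^ d \<le> 4 * (4 * d * k - k) ^ d"
proof -
  let ?t = "1 - 1 / (4 * real d)"
  have "1 + real d * (- (1 / (4 * real d))) \<le> (1 + - (1 / (4 * real d))) ^ d"
    using assms by (intro Bernoulli_inequality) (auto simp: field_simps)
  then have "3 \<le> 4 * ?t ^ d" using assms by simp
  then have "3 * real (4 * d * k) ^ d \<le> 4 * ?t ^ d * real (4 * d * k) ^ d"
    by (intro mult_right_mono) auto
  also have "\<dots> = 4 * (?t * real (4 * d * k)) ^ d" by (simp add: power_mult_distrib)
  also have "?t * real (4 * d * k) = real (4 * d * k - k)"
    using assms by (subst of_nat_diff) (auto simp: field_simps)
  finally have "real (3 * (4 * d * k) ^ d) \<le> real (4 * (4 * d * k - k) ^ d)" by simp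
  then show ?thesis by (simp only: of_nat_le_iff)
qed

text \<open>The edges are the translations of a grid by the points \<open>a\<close> of a sphere. The linear form
  \<open>x \<mapsto> -\<langle>a, x\<rangle>\<close>, raised by \<open>\<langle>a, a\<rangle>\<close> on the right side, is constant along \<open>a\<close> and increases by
  \<open>\<langle>a, a\<rangle> - \<langle>a, b\<rangle> > 0\<close> along \<open>b \<noteq> a\<close>.\<close>

lemma ex_separated_matchings:
  assumes d: "3 \<le> d" and k: "1 \<le> k"
  shows "\<exists>(L :: nat set) R (C :: (nat \<Rightarrow> int) set) N h. separated_matchings L R C N h \<and>
    card (L \<union> R) = 2 * (4 * d * k) ^ d \<and> k ^ d \<le> d * k\<^sup>2 * card C"
proof -
  define m where "m = 4 * d * k"
  obtain A r where A: "A \<subseteq> cube d k" and r: "\<And>a. a \<in> A \<Longrightarrow> ip d a a = r"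
    and card_A: "k ^ d \<le> d * k\<^sup>2 * card A"
    using ex_sphere_in_cube[of d k] d k by auto
  define W where "W = (UNIV :: bool set) \<times> cube d m"
  have "finite W" by (simp add: W_def finite_cube)
  \<comment> \<open>Vertices are to be natural numbers, so two copies of the grid, tagged by side,
    are encoded injectively.\<close>
  then obtain \<iota> :: "bool \<times> (nat \<Rightarrow> int) \<Rightarrow> nat" where \<iota>: "inj_on \<iota> W"
    using finite_imp_inj_to_nat_seg by blast
  have \<iota>_eq: "\<iota> (b, x) = \<iota> (c, y) \<longleftrightarrow> b = c \<and> x = y" if "x \<in> cube d m" "y \<in> cube d m" for b c x y
    using inj_on_eq_iff[OF \<iota>, of "(b, x)" "(c, y)"] that by (auto simp: W_def)
  define L where "L = \<iota> ` ({False} \<times> cube d m)"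
  define R where "R = \<iota> ` ({True} \<times> cube d m)"
  define tr where "tr a x = restrict (\<lambda>i. x i + a i) {..<d}" for a x :: "nat \<Rightarrow> int"
  \<comment> \<open>Coordinates of the translation vectors are below \<open>k\<close>, so starting
    points in the grid of side \<open>m - k\<close> stay inside the grid of side
    \<open>m\<close>.\<close>
  define N where "N a = (\<lambda>x. (\<iota> (False, x), \<iota> (True, tr a x))) ` cube d (m - k)" for a
  define h where "h a v = (case inv_into W \<iota> v of (b, x) \<Rightarrow>
    (if b then ip d a a else 0) - ip d a x)" for a v
  have "k \<le> m" using d by (simp add: m_def)
  then have sub: "x \<in> cube d m" if "x \<in> cube d (m - k)" for x
    using that by (force simp: cube_def PiE_iff)
  have tr: "tr a x \<in> cube d m" if "x \<in> cube d (m - k)" "a \<in> A" for a x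
  proof -
    have "0 \<le> x i + a i \<and> x i + a i < int m" if "i < d" for i
    proof -
      have "0 \<le> x i" "x i < int (m - k)" "0 \<le> a i" "a i < int k"
        using \<open>x \<in> _\<close> \<open>a \<in> A\<close> A that by (auto simp: cube_def PiE_iff)
      then show ?thesis using \<open>k \<le> m\<close> by linarith
    qed
    then show ?thesis by (auto simp: cube_def tr_def)
  qed
  have tr_inj: "x = y" if "tr a x = tr a y" "x \<in> cube d (m - k)" "y \<in> cube d (m - k)" for a x y
  proof (rule PiE_ext)
    show "x \<in> PiE {..<d} (\<lambda>_. {0..<int (m - k)})" "y \<in> PiE {..<d} (\<lambda>_. {0..<int (m - k)})"
      using that by (auto simp: cube_def)
    show "x i = y i" if "i \<in> {..<d}" for i
      using fun_cong[OF \<open>tr a x = tr a y\<close>, of i] that by (simp add: tr_def)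
  qed
  have h: "h a (\<iota> (b, x)) = (if b then ip d a a else 0) - ip d a x" if "x \<in> cube d m" for a b x
    using that \<iota> by (simp add: h_def inv_into_f_f W_def)
  have ip_tr: "ip d a (tr b x) = ip d a x + ip d a b" for a b x
    by (simp add: ip_def tr_def sum.distrib[symmetric] algebra_simps)
  have card_V: "card (L \<union> R) = 2 * m ^ d"
  proof -
    have "L \<union> R = \<iota> ` W" by (auto simp: L_def R_def W_def)
    then show ?thesis using \<iota> by (simp add: card_image W_def card_cartesian_product card_cube)
  qed
  have card_N: "card (N a) = (m - k) ^ d" for a
    unfolding N_def by (subst card_image) (auto simp: inj_on_def \<iota>_eq sub card_cube)
  have "separated_matchings L R A N h"
  proof
    show "finite L" "finite R" "finite A"
      using finite_subset[OF A finite_cube] by (auto simp: L_def R_def finite_cube)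
    show "L \<inter> R = {}" by (auto simp: L_def R_def \<iota>_eq)
    fix a assume a: "a \<in> A"
    show "N a \<subseteq> L \<times> R" using a by (auto simp: N_def L_def R_def sub tr)
    show "inj_on fst (N a)" by (auto simp: N_def inj_on_def \<iota>_eq sub)
    show "inj_on snd (N a)" using a by (auto simp: N_def inj_on_def \<iota>_eq tr dest: tr_inj)
    show "3 * card (L \<union> R) \<le> 8 * card (N a)"
      using three_quarters_cube[of d k] d by (simp add: card_V card_N m_def)
    \<comment> \<open>Since \<open>m - k\<close> is at least 4 and \<open>d\<close> at least 3, a
      matching has at least 64 edges.\<close>
    have "5 * k \<le> 4 * d * k" using d by (intro mult_le_mono1) simp
    then have "4 * k \<le> m - k" unfolding m_def by linarith
    then have "(4 :: nat) ^ 3 \<le> (m - k) ^ d"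
      using d k by (intro order_trans[OF power_increasing[of 3 d 4] power_mono]) auto
    then show "54 \<le> card (N a)" by (simp add: card_N)
    show "h a u = h a v" if "(u, v) \<in> N a" for u v
      using that a by (auto simp: N_def h sub tr ip_tr)
    show "h a u < h a v" if "b \<in> A" "a \<noteq> b" "(u, v) \<in> N b" for b u v
    proof -
      have "ip d a b < ip d a a"
        using that a A r ip_less_of_same_norm[of a d k b] by blast
      then show ?thesis using that by (auto simp: N_def h sub tr ip_tr r)
    qed
  qed
  then show ?thesis using card_V card_A unfolding m_def by blast
qed

section \<open>Choice of parameters and asymptotics\<close>

text \<open>The left side is a constant times \<open>k\<close> to the power d(1 - 2\<delta>). As
  d\<delta> > 1, this exponent is below d - 2, so large \<open>k\<close> absorbs all factors
  depending on d, \<delta> and \<epsilon>.\<close>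

lemma eventually_powr_grid_size_le:
  fixes \<epsilon> \<delta> :: real
  assumes "0 < \<epsilon>" "0 < d" and d: "1 < real d * \<delta>"
  shows "\<forall>\<^sub>F k :: nat in sequentially.
    6 * real d * (real (2 * (4 * d * k) ^ d) powr (1 - 2 * \<delta>) / \<epsilon>) \<le> real k powr (real d - 2)"
proof -
  define B where "B = 6 * real d * (2 * (4 * real d) ^ d) powr (1 - 2 * \<delta>) / \<epsilon>"
  define \<alpha> where "\<alpha> = real d * (1 - 2 * \<delta>)"
  define \<beta> where "\<beta> = real d - 2"
  have "0 < B" using assms by (simp add: B_def)
  have "\<alpha> < \<beta>" using d by (simp add: \<alpha>_def \<beta>_def algebra_simps)
  have "\<forall>\<^sub>F k :: nat in sequentially. B * real k powr \<alpha> \<le> real k powr \<beta>"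
    using \<open>0 < B\<close> \<open>\<alpha> < \<beta>\<close> by real_asymp
  then show ?thesis
    using eventually_gt_at_top[of "0 :: nat"]
  proof eventually_elim
    case (elim k)
    have "real (2 * (4 * d * k) ^ d) = (2 * (4 * real d) ^ d) * real k powr real d"
      using elim by (simp add: powr_realpow power_mult_distrib)
    then have "real (2 * (4 * d * k) ^ d) powr (1 - 2 * \<delta>)
        = (2 * (4 * real d) ^ d) powr (1 - 2 * \<delta>) * real k powr \<alpha>"
      by (simp add: powr_mult powr_powr \<alpha>_def)
    then show ?case using elim by (simp add: B_def \<beta>_def)
  qed
qed

theorem theorem3p12:
  "\<exists>c::real. c > 0 \<and>
     (\<forall>\<epsilon> \<delta> :: real. 0 < \<epsilon> \<longrightarrow> \<epsilon> \<le> 1 / 8 \<longrightarrow> 0 < \<delta> \<longrightarrow>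
        infinite {n. \<exists>(V :: nat set) E.
          bipartite_dag V E \<and> card V = n \<and>
          (\<forall>M q. monotonicity_tester V E \<epsilon> M \<and> nonadaptive M \<and> makes_at_most_queries M q \<longrightarrow>
             real q \<ge> c * (real n powr (1 / 2 - \<delta>) / sqrt \<epsilon>))})"
proof (intro exI[of _ 1] conjI allI impI)
  fix \<epsilon> \<delta> :: real
  assume \<epsilon>: "0 < \<epsilon>" "\<epsilon> \<le> 1 / 8" and \<delta>: "0 < \<delta>"
  let ?S = "{n. \<exists>(V :: nat set) E.
    bipartite_dag V E \<and> card V = n \<and>
    (\<forall>M q. monotonicity_tester V E \<epsilon> M \<and> nonadaptive M \<and> makes_at_most_queries M q \<longrightarrow>
       real q \<ge> 1 * (real n powr (1 / 2 - \<delta>) / sqrt \<epsilon>))}"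
  obtain d0 :: nat where d0: "1 / \<delta> < real d0" using reals_Archimedean2 by blast
  \<comment> \<open>The dimension must exceed 1/\<delta> for the comparison of exponents and be at
    least 3 for the matchings.\<close>
  define d where "d = max 3 d0"
  have d3: "3 \<le> d" by (simp add: d_def)
  have "1 / \<delta> < real d" using d0 by (simp add: d_def)
  then have d\<delta>: "1 < real d * \<delta>" using \<delta> by (simp add: field_simps)
  define n where "n k = 2 * (4 * d * k) ^ d" for k
  obtain K where K: "\<And>k. k \<ge> K \<Longrightarrow>
      6 * real d * (real (n k) powr (1 - 2 * \<delta>) / \<epsilon>) \<le> real k powr (real d - 2)"
    using eventually_powr_grid_size_le[OF \<epsilon>(1) _ d\<delta>] d3
    unfolding n_def eventually_sequentially by auto
  have "n k \<in> ?S" if k: "k \<ge> max 1 K" for k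
  proof -
    obtain L R :: "nat set" and C :: "(nat \<Rightarrow> int) set" and N h
      where sep: "separated_matchings L R C N h" and card_V: "card (L \<union> R) = n k"
        and card_C: "k ^ d \<le> d * k\<^sup>2 * card C"
      using ex_separated_matchings[OF d3, of k] k unfolding n_def by auto
    interpret separated_matchings L R C N h by (fact sep)
    have "real q \<ge> real (n k) powr (1 / 2 - \<delta>) / sqrt \<epsilon>"
      if "monotonicity_tester V E \<epsilon> M" "nonadaptive M" "makes_at_most_queries M q" for M q
    proof -
      have "real k powr real d \<le> real d * real k ^ 2 * real (card C)"
        using card_C k by (simp add: powr_realpow flip: of_nat_power of_nat_mult of_nat_le_iff)
      \<comment> \<open>The sphere supplies at least \<open>k powr (d - 2) / d\<close>
        matchings.\<close>
      then have C: "real k powr (real d - 2) \<le> real d * real (card C)"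
        using k by (simp add: powr_diff field_simps)
      have "6 * real d * (real (n k) powr (1 - 2 * \<delta>) / \<epsilon>) \<le> 6 * real d * (real (card C) / 6)"
        using K[of k] k C by simp
      then have "real (n k) powr (1 - 2 * \<delta>) / \<epsilon> \<le> real (card C) / 6"
        using d3 by (simp only: mult_le_cancel_left_pos)
      also have "\<dots> \<le> (real q)\<^sup>2"
        using queries_lower_bound[OF \<epsilon>(2) that] .
      finally have "(real (n k) powr (1 / 2 - \<delta>) / sqrt \<epsilon>)\<^sup>2 \<le> (real q)\<^sup>2"
        using \<epsilon>(1) by (simp add: power_divide power2_eq_square flip: powr_add)
      then show ?thesis by (rule power2_le_imp_le) simp
    qed
    then show ?thesis using bipartite card_V by auto
  qed
  then have "n ` {max 1 K..} \<subseteq> ?S" by blast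
  \<comment> \<open>Distinct \<open>k\<close> give distinct sizes, so infinitely many sizes
    occur.\<close>
  moreover have "inj_on n {max 1 K..}"
    using d3 by (auto simp: inj_on_def n_def power_eq_iff_eq_base)
  then have "infinite (n ` {max 1 K..})"
    using finite_imageD infinite_Ici by blast
  ultimately show "infinite ?S" by (rule infinite_super)
qed simp

end
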